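(* Let $\Sigma$ be a relational schema, $q$ a Boolean conjunctive query over $\Sigma$, and $D$ a database over $\Sigma$. A key component $K$ of $D$ is strongly redundant if there is an atom $a \in K$ such that one of the following two conditions is satisfied: (1) $\{\mu \in \mathit{sub}(q,D) : a \in \mu(q)\} = \emptyset$; or (2) $\{\mu \in \mathit{sub}(q,D) : a \in \mu(q)\} = \{\mu \in \mathit{sus}(q,D) : a \in \mu(q)\}$.
   Context: Fix disjoint countably infinite sets $\mathbf{C}$ (constants) and $\mathbf{V}$ (variables). A relational schema is a triple $\Sigma=\langle \mathcal{R},\alpha,\kappa\rangle$ with $\mathcal{R}$ a finite set of relation symbols, $\alpha:\mathcal{R}\to\mathbb{N}$ giving arities, and $\kappa$ assigning to each $r\in\mathcal{R}$ a nonempty set $\kappa(r)\subseteq\{1,\ldots,\alpha(r)\}$ (the primary key positions). An atom is $r(t_1,\ldots,t_{\alpha(r)})$ with terms $t_i\in\mathbf{C}\cup\mathbf{V}$; it is a fact if all terms are constants. A database is a finite set of facts. For an atom $r(\mathbf{t})$, $\hat{\mathbf{t}}$ is the subsequence of $\mathbf{t}$ at the positions in $\kappa(r)$. A substitution is a map $\mu:\mathbf{C}\cup\mathbf{V}\to\mathbf{C}\cup\mathbf{V}$ that is the identity on $\mathbf{C}$, extended to (sets of) atoms termwise. A Boolean conjunctive query (BCQ) $q$ is an existentially closed conjunction of atoms (possibly with constants), identified with the set of its atoms. Let $\mathit{var}(q)$ be the set of variables of $q$ and, for a database $D$, $\mathit{sub}(q,D)=\{\mu|_{\mathit{var}(q)}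 : \mu \text{ is a substitution and } \mu(q)\subseteq D\}$. A key component of $D$ is a maximal subset $K\subseteq D$ such that any two facts $r_1(\mathbf{t}_1),r_2(\mathbf{t}_2)\in K$ satisfy $r_1=r_2$ and $\hat{\mathbf{t}}_1=\hat{\mathbf{t}}_2$. The key components partition $D$; removing some of them from $D$ leaves a database whose key components are the remaining ones. Pruning criterion: a key component $K$ of a database $D'$ satisfies the criterion in $D'$ if $K\setminus\bigcup_{\mu\in\mathit{sub}(q,D')}\mu(q)\neq\emptyset$, i.e. some fact of $K$ belongs to $\mu(q)$ for no $\mu\in\mathit{sub}(q,D')$. A key component $K$ of $D$ is strongly redundant (w.r.t. $q$) if it can be identified by repeatedly applying this criterion and removing the components found, i.e. if there is a finite sequence $K_1,\ldots,K_m$ of distinct key components of $D$ with $K_m=K$ such that, for each $i\in\{1,\ldots,m\}$, $K_i$ satisfies the criterion in $D\setminus(K_1\cup\cdots\cup K_{i-1})$. A substitution $\mu\in\mathit{sub}(q,D)$ is strongly unfounded if $\mu(q)\cap K\neq\emptyset$ for some strongly redundant key component $K$ of $D$. $\mathit{sus}(q,D)$ is the set of all strongly unfounded substitutions in $\mathit{sub}(q,D)$. *)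

theory Defs
  imports Main "HOL-Library.FuncSet" "HOL-Library.Countable" "HOL-Library.Infinite_Typeclass"
begin

record 'r schema =
  rels :: "'r set"
  arity :: "'r \<Rightarrow> nat"
  keypos :: "'r \<Rightarrow> nat set"

definition schema :: "'r schema \<Rightarrow> bool" where
  "schema S \<longleftrightarrow> finite (rels S) \<and>
     (\<forall>r\<in>rels S. keypos S r \<noteq> {} \<and> keypos S r \<subseteq> {1..arity S r})"

text \<open>The two constructors make the sets of constants and of variables disjoint.\<close>

datatype ('c, 'v) trm = Const 'c | Var 'v

datatype ('r, 'c, 'v) atom = Atom (rel: 'r) (args: "('c, 'v) trm list")

definition atom_over :: "'r schema \<Rightarrow> ('r, 'c, 'v) atom \<Rightarrow> bool" where
  "atom_over S a \<longleftrightarrow> rel a \<in> rels S \<and> length (args a) = arity S (rel a)"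

definition is_fact :: "('r, 'c, 'v) atom \<Rightarrow> bool" where
  "is_fact a \<longleftrightarrow> set (args a) \<subseteq> range Const"

definition database :: "'r schema \<Rightarrow> ('r, 'c, 'v) atom set \<Rightarrow> bool" where
  "database S D \<longleftrightarrow> finite D \<and> (\<forall>a\<in>D. atom_over S a \<and> is_fact a)"

definition bcq :: "'r schema \<Rightarrow> ('r, 'c, 'v) atom set \<Rightarrow> bool" where
  "bcq S q \<longleftrightarrow> finite q \<and> (\<forall>a\<in>q. atom_over S a)"

text \<open>Key positions are counted from 1, whereas \<open>nths\<close> counts from 0.\<close>

definition key :: "'r schema \<Rightarrow> ('r, 'c, 'v) atom \<Rightarrow> ('c, 'v) trm list" where
  "key S a = nths (args a) {i. Suc i \<in> keypos S (rel a)}"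

definition key_equal :: "'r schema \<Rightarrow> ('r, 'c, 'v) atom set \<Rightarrow> bool" where
  "key_equal S K \<longleftrightarrow> (\<forall>a\<in>K. \<forall>b\<in>K. rel a = rel b \<and> key S a = key S b)"

definition key_component ::
  "'r schema \<Rightarrow> ('r, 'c, 'v) atom set \<Rightarrow> ('r, 'c, 'v) atom set \<Rightarrow> bool" where
  "key_component S D K \<longleftrightarrow>
     K \<subseteq> D \<and> key_equal S K \<and> (\<forall>K'. K \<subset> K' \<and> K' \<subseteq> D \<longrightarrow> \<not> key_equal S K')"

definition substitution :: "(('c, 'v) trm \<Rightarrow> ('c, 'v) trm) \<Rightarrow> bool" where
  "substitution \<mu> \<longleftrightarrow> (\<forall>c. \<mu> (Const c) = Const c)"

definition subst_atom ::
  "(('c, 'v) trm \<Rightarrow> ('c, 'v) trm) \<Rightarrow> ('r, 'c, 'v) atom \<Rightarrow> ('r, 'c, 'v) atom" where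
  "subst_atom \<mu> a = Atom (rel a) (map \<mu> (args a))"

definition subst_atoms ::
  "(('c, 'v) trm \<Rightarrow> ('c, 'v) trm) \<Rightarrow> ('r, 'c, 'v) atom set \<Rightarrow> ('r, 'c, 'v) atom set" where
  "subst_atoms \<mu> q = subst_atom \<mu> ` q"

definition vars :: "('r, 'c, 'v) atom set \<Rightarrow> 'v set" where
  "vars q = {v. \<exists>a\<in>q. Var v \<in> set (args a)}"

text \<open>The restriction of a substitution to the variables of \<open>q\<close> keeps the constants in its
  domain, where it is the identity, so that it can still be applied to the atoms of \<open>q\<close>.\<close>

definition sub ::
  "('r, 'c, 'v) atom set \<Rightarrow> ('r, 'c, 'v) atom set \<Rightarrow> (('c, 'v) trm \<Rightarrow> ('c, 'v) trm) set" where
  "sub q D = {restrict \<mu> (range Const \<union> Var ` vars q) | \<mu>.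
                substitution \<mu> \<and> subst_atoms \<mu> q \<subseteq> D}"

definition prunable ::
  "'r schema \<Rightarrow> ('r, 'c, 'v) atom set \<Rightarrow> ('r, 'c, 'v) atom set \<Rightarrow> ('r, 'c, 'v) atom set \<Rightarrow> bool" where
  "prunable S q D K \<longleftrightarrow>
     key_component S D K \<and> K - (\<Union>\<mu>\<in>sub q D. subst_atoms \<mu> q) \<noteq> {}"

definition strongly_redundant ::
  "'r schema \<Rightarrow> ('r, 'c, 'v) atom set \<Rightarrow> ('r, 'c, 'v) atom set \<Rightarrow> ('r, 'c, 'v) atom set \<Rightarrow> bool" where
  "strongly_redundant S q D K \<longleftrightarrow>
     (\<exists>Ks. Ks \<noteq> [] \<and> distinct Ks \<and> (\<forall>K'\<in>set Ks. key_component S D K') \<and> last Ks = K \<and>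
        (\<forall>i<length Ks. prunable S q (D - \<Union>(set (take i Ks))) (Ks ! i)))"

definition sus ::
  "'r schema \<Rightarrow> ('r, 'c, 'v) atom set \<Rightarrow> ('r, 'c, 'v) atom set \<Rightarrow>
     (('c, 'v) trm \<Rightarrow> ('c, 'v) trm) set" where
  "sus S q D = {\<mu> \<in> sub q D. \<exists>K. key_component S D K \<and> strongly_redundant S q D K \<and>
                  subst_atoms \<mu> q \<inter> K \<noteq> {}}"

end

(* Pruning is monotone: removing further components cannot make a prunable component lose this
   property. Hence a longest pruning sequence already contains every strongly redundant component.
   If K is not in it, no substitution surviving the pruning can cover a, so K could be appended. *)

theory Submission
  imports Defs
begin

text \<open>The conditions of \<open>strongly_redundant\<close> without the demands on nonemptiness
  and on the last component. In this form they hold for the empty list and pass to prefixes, so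
  sequences can be grown and cut at their end.\<close>

definition pruning_sequence ::
  "'r schema \<Rightarrow> ('r, 'c, 'v) atom set \<Rightarrow> ('r, 'c, 'v) atom set \<Rightarrow>
     ('r, 'c, 'v) atom set list \<Rightarrow> bool" where
  "pruning_sequence S q D Ks \<longleftrightarrow>
     distinct Ks \<and> (\<forall>K\<in>set Ks. key_component S D K) \<and>
     (\<forall>i<length Ks. prunable S q (D - \<Union>(set (take i Ks))) (Ks ! i))"

lemma pruning_sequence_Nil: "pruning_sequence S q D []"
  by (simp add: pruning_sequence_def)

lemma pruning_sequence_snoc:
  "pruning_sequence S q D (Ks @ [K]) \<longleftrightarrow>
     pruning_sequence S q D Ks \<and> K \<notin> set Ks \<and> key_component S D K \<and>
     prunable S q (D - \<Union>(set Ks)) K"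
  by (auto simp: pruning_sequence_def nth_append All_less_Suc)

lemma pruning_sequence_appendD:
  "pruning_sequence S q D (Ks @ Ls) \<Longrightarrow> pruning_sequence S q D Ks"
proof (induction Ls rule: rev_induct)
  case (snoc L Ls)
  then show ?case
    using pruning_sequence_snoc[of S q D "Ks @ Ls" L] by simp
qed simp

text \<open>Each test depends only on the components removed before it, so a sequence may be cut
  right after \<open>K\<close>.\<close>

lemma strongly_redundant_iff:
  "strongly_redundant S q D K \<longleftrightarrow> (\<exists>Ks. pruning_sequence S q D Ks \<and> K \<in> set Ks)"
proof
  assume "strongly_redundant S q D K"
  then show "\<exists>Ks. pruning_sequence S q D Ks \<and> K \<in> set Ks"
    unfolding strongly_redundant_def pruning_sequence_def by (metis last_in_set)
next
  assume "\<exists>Ks. pruning_sequence S q D Ks \<and> K \<in> set Ks"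
  then obtain Ks Ls where "pruning_sequence S q D (Ks @ K # Ls)"
    by (metis split_list)
  then have "pruning_sequence S q D (Ks @ [K])"
    using pruning_sequence_appendD[of S q D "Ks @ [K]" Ls] by simp
  then show "strongly_redundant S q D K"
    unfolding strongly_redundant_def pruning_sequence_def
    by (intro exI[of _ "Ks @ [K]"]) simp
qed

text \<open>A shared atom would link all of \<open>K \<union> L\<close> by the same relation and
  key, and maximality would then force \<open>K = L\<close>.\<close>

lemma key_component_disjoint:
  assumes "key_component S D K" "key_component S D L" "K \<noteq> L"
  shows "K \<inter> L = {}"
proof (rule ccontr)
  assume "K \<inter> L \<noteq> {}"
  then obtain a where "a \<in> K" "a \<in> L"
    by blast
  with assms have "key_equal S (K \<union> L)"
    unfolding key_component_def key_equal_def by (metis Un_iff)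
  with assms show False
    unfolding key_component_def by (metis Un_subset_iff Un_upper1 Un_upper2 psubsetI)
qed

text \<open>Disjointness leaves \<open>K\<close> intact, and a smaller database offers fewer
  supersets that could violate maximality.\<close>

lemma key_component_Diff:
  assumes "key_component S D K" "\<forall>L\<in>\<K>. key_component S D L" "K \<notin> \<K>"
  shows "key_component S (D - \<Union>\<K>) K"
proof -
  have "K \<inter> \<Union>\<K> = {}"
    using assms key_component_disjoint by blast
  with assms(1) show ?thesis
    unfolding key_component_def by blast
qed

lemma sub_mono: "D \<subseteq> E \<Longrightarrow> sub q D \<subseteq> sub q E"
  unfolding sub_def by blast

text \<open>Every term of \<open>q\<close> is a constant or one of its variables, so the value
  \<open>undefined\<close> outside the domain is never reached.\<close>

lemma subst_atoms_restrict:
  "subst_atoms (restrict \<mu> (range Const \<union> Var ` vars q)) q = subst_atoms \<mu> q"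
proof -
  have "t \<in> range Const \<union> Var ` vars q" if "a \<in> q" "t \<in> set (args a)" for a t
    using that by (cases t) (auto simp: vars_def)
  then show ?thesis
    unfolding subst_atoms_def subst_atom_def by (intro image_cong) auto
qed

lemma subst_atoms_sub_subset: "\<mu> \<in> sub q D \<Longrightarrow> subst_atoms \<mu> q \<subseteq> D"
  unfolding sub_def by (auto simp: subst_atoms_restrict)

text \<open>A smaller database admits fewer substitutions, so a fact of \<open>K\<close> left
  uncovered in \<open>E\<close> stays uncovered in \<open>D\<close>.\<close>

lemma prunable_mono:
  assumes "prunable S q E K" "D \<subseteq> E" "key_component S D K"
  shows "prunable S q D K"
  using assms sub_mono[OF assms(2), of q] unfolding prunable_def by blast

lemma pruning_sequence_extend:
  assumes Ks: "pruning_sequence S q D Ks"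
    and "strongly_redundant S q D K" "K \<notin> set Ks"
  shows "\<exists>L. pruning_sequence S q D (Ks @ [L])"
proof -
  obtain Ls where Ls: "pruning_sequence S q D Ls" and "K \<in> set Ls"
    using assms(2) by (auto simp: strongly_redundant_iff)
  \<comment> \<open>\<open>L\<close> is the first component of \<open>Ls\<close> missing from
    \<open>Ks\<close>; it may differ from \<open>K\<close>. Its predecessors \<open>Ms\<close> all
    occur in \<open>Ks\<close>, so removing \<open>Ks\<close> leaves a subset of what removing
    \<open>Ms\<close> leaves, and \<open>prunable_mono\<close> applies to \<open>L\<close>.\<close>
  then obtain Ms L Ns where split: "Ls = Ms @ L # Ns" and L: "L \<notin> set Ks"
    and Ms: "\<forall>M\<in>set Ms. M \<in> set Ks"
    using split_list_first_prop[of Ls "\<lambda>L. L \<notin> set Ks"] assms(3) by blast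
  have "pruning_sequence S q D (Ms @ [L])"
    using Ls split pruning_sequence_appendD[of S q D "Ms @ [L]" Ns] by simp
  then have comp: "key_component S D L" and prun: "prunable S q (D - \<Union>(set Ms)) L"
    by (simp_all add: pruning_sequence_snoc)
  have "key_component S (D - \<Union>(set Ks)) L"
    using key_component_Diff[OF comp _ L] Ks by (simp add: pruning_sequence_def)
  then have "prunable S q (D - \<Union>(set Ks)) L"
    using prunable_mono[OF prun] Ms by blast
  then show ?thesis
    using Ks L comp pruning_sequence_snoc by blast
qed

text \<open>Guarantees that a longest sequence exists: only finitely many distinct lists can be
  formed from the subsets of \<open>D\<close>.\<close>

lemma finite_pruning_sequences:
  assumes "finite D"
  shows "finite {Ks. pruning_sequence S q D Ks}"
proof (rule finite_subset)
  show "{Ks. pruning_sequence S q D Ks} \<subseteq> {Ks. set Ks \<subseteq> Pow D \<and> distinct Ks}"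
    by (auto simp: pruning_sequence_def key_component_def)
  show "finite {Ks. set Ks \<subseteq> Pow D \<and> distinct Ks}"
    using assms by (intro finite_subset_distinct) simp
qed

lemma ex_complete_pruning_sequence:
  assumes "finite D"
  obtains Ks where "pruning_sequence S q D Ks"
    and "\<And>K. strongly_redundant S q D K \<Longrightarrow> K \<in> set Ks"
proof -
  let ?N = "length ` {Ks. pruning_sequence S q D Ks}"
  have "finite ?N" "?N \<noteq> {}"
    using finite_pruning_sequences[OF assms] pruning_sequence_Nil by blast+
  then have "Max ?N \<in> ?N" and ge: "\<And>n. n \<in> ?N \<Longrightarrow> n \<le> Max ?N"
    by simp_all
  then obtain Ks where Ks: "pruning_sequence S q D Ks" and "length Ks = Max ?N"
    by (metis (no_types, lifting) imageE mem_Collect_eq)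
  with ge have max: "\<And>Ls. pruning_sequence S q D Ls \<Longrightarrow> length Ls \<le> length Ks"
    by simp
  \<comment> \<open>A missing component would yield a sequence longer by one.\<close>
  have "K \<in> set Ks" if "strongly_redundant S q D K" for K
    using pruning_sequence_extend[OF Ks that] max by fastforce
  with Ks show thesis
    by (rule that)
qed

theorem proposition4:
  fixes S :: "'r schema"
    and q D K :: "('r, 'c::{countable,infinite}, 'v::{countable,infinite}) atom set"
  assumes "schema S" and "bcq S q" and "database S D"
    and "key_component S D K"
    and "\<exists>a\<in>K. {\<mu> \<in> sub q D. a \<in> subst_atoms \<mu> q} = {} \<or>
           {\<mu> \<in> sub q D. a \<in> subst_atoms \<mu> q} = {\<mu> \<in> sus S q D. a \<in> subst_atoms \<mu> q}"
  shows "strongly_redundant S q D K"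
proof -
  have "finite D"
    using assms(3) by (simp add: database_def)
  then obtain Ks where Ks: "pruning_sequence S q D Ks"
    and complete: "\<And>L. strongly_redundant S q D L \<Longrightarrow> L \<in> set Ks"
    using ex_complete_pruning_sequence[of D S q] by blast
  \<comment> \<open>Both alternatives give this implication, the first one vacuously.\<close>
  obtain a where "a \<in> K"
    and unfounded: "\<And>\<mu>. \<lbrakk>\<mu> \<in> sub q D; a \<in> subst_atoms \<mu> q\<rbrakk> \<Longrightarrow> \<mu> \<in> sus S q D"
    using assms(5) by blast
  show ?thesis
  proof (cases "K \<in> set Ks")
    case True
    with Ks show ?thesis
      by (auto simp: strongly_redundant_iff)
  next
    case False
    let ?D = "D - \<Union>(set Ks)"
    have "a \<notin> subst_atoms \<mu> q" if "\<mu> \<in> sub q ?D" for \<mu>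
    proof
      assume "a \<in> subst_atoms \<mu> q"
      moreover have "\<mu> \<in> sub q D"
        using that sub_mono[of ?D D q] by blast
      ultimately have "\<mu> \<in> sus S q D"
        by (rule unfounded[rotated])
      \<comment> \<open>The component witnessing that \<open>\<mu>\<close> is strongly unfounded has
        been removed by \<open>Ks\<close>, yet \<open>\<mu>\<close> maps \<open>q\<close> into
        \<open>?D\<close>.\<close>
      then obtain L where "L \<in> set Ks" "subst_atoms \<mu> q \<inter> L \<noteq> {}"
        using complete by (auto simp: sus_def)
      with subst_atoms_sub_subset[OF that] show False
        by blast
    qed
    moreover have "key_component S ?D K"
      using key_component_Diff[OF assms(4) _ False] Ks by (simp add: pruning_sequence_def)
    ultimately have "prunable S q ?D K"
      using \<open>a \<in> K\<close> by (auto simp: prunable_def)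
    with Ks False assms(4) have "pruning_sequence S q D (Ks @ [K])"
      by (simp add: pruning_sequence_snoc)
    then show ?thesis
      by (auto simp: strongly_redundant_iff)
  qed
qed

end
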